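(* Let $n\ge 2$, let $\mathfrak h\subset\mathfrak{sl}_n(\mathbb C)$ be the Cartan subalgebra of traceless diagonal matrices, and let $\mathfrak f$ be a Lie subalgebra with $\mathfrak h\subset\mathfrak f\subset\mathfrak{sl}_n(\mathbb C)$. Suppose that $\mathfrak f$ has a small Frobenius functional $F_S$, i.e. $S$ is a set of pairs such that $F_S$ is small and the restriction of $F_S$ to $\mathfrak f$ is a Frobenius functional on $\mathfrak f$. Then the diagonal matrix $D_S$ is the principal element of $F_S$ on $\mathfrak f$: $D_S=\widehat F_S$.
   Context: All Lie algebras are finite-dimensional over $\mathbb C$. For a Lie algebra $\mathfrak f$ and $F\in\mathfrak f^*$, $F$ is a Frobenius functional if the skew-symmetric form $B_F(x,y)=F([x,y])$ on $\mathfrak f$ is non-degenerate; its principal element is then the unique $\widehat F\in\mathfrak f$ with $F(x)=F([\widehat F,x])$ for all $x\in\mathfrak f$. Let $e_{ij}$ denote the $n\times n$ matrix units and $e_{ij}^*$ the functional on $n\times n$ matrices giving the $(i,j)$ entry. For a set $S$ of ordered pairs $(i,j)$ with $i\neq j$, $1\le i,j\le n$, let $F_S=\sum_{(i,j)\in S}e_{ij}^*$, a functional on $\mathfrak{sl}_n$ (restricted to any subalgebra), and let $\Gamma_S$ be the directed graph with vertex set $\{1,\dots,n\}$ and a directed edge from $i$ to $j$ for each $(i,j)\in S$. $F_S$ is called small if $\#S=n-1$ and $\Gamma_S$ is connected (as an undirected graph; hence it is a tree). For such $S$, set $\varepsilon_k=e_{kk}-\frac1n I$, where $I$ is the $n\times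 n$ identity matrix. For $s=(i,j)\in S$, removing the edge from $i$ to $j$ disconnects $\Gamma_S$, so each $k\in\{1,\dots,n\}$ remains connected to exactly one of $i$, $j$; let $d_s$ be the sum of all $\varepsilon_k$ with $k$ still connected to $i$ (including $k=i$). Set $D_S=\sum_{s\in S}d_s$. *)

theory Defs
  imports "HOL-Analysis.Analysis" "Graph_Theory.Digraph_Component"
begin

definition matrix_unit :: "'n::finite \<Rightarrow> 'n \<Rightarrow> complex ^ 'n ^ 'n" where
  "matrix_unit i j = (\<chi> a b. if a = i \<and> b = j then 1 else 0)"

definition cscale :: "complex \<Rightarrow> complex ^ 'n::finite ^ 'n \<Rightarrow> complex ^ 'n ^ 'n" where
  "cscale c = map_matrix ((*) c)"

definition cmat_basis :: "(complex ^ 'n::finite ^ 'n) set" where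
  "cmat_basis = range (\<lambda>(i, j). matrix_unit i j)"

text \<open>The vector space structure from the library's analysis classes is real;
  subspaces below are complex ones, i.e. \<open>cmat.subspace\<close>.\<close>

lemma vector_space_cscale: "vector_space (cscale :: complex \<Rightarrow> complex ^ 'n::finite ^ 'n \<Rightarrow> _)"
  by unfold_locales (simp_all add: cscale_def vec_eq_iff algebra_simps)

lemma sum_cscale_matrix_unit:
  fixes A :: "complex ^ 'n::finite ^ 'n"
  shows "(\<Sum>(i, j)\<in>UNIV. cscale (A $ i $ j) (matrix_unit i j)) = A"
proof -
  have "(\<Sum>p\<in>UNIV. cscale (A $ fst p $ snd p) (matrix_unit (fst p) (snd p))) $ a $ b = A $ a $ b" for a b
  proof -
    have "(\<Sum>p\<in>UNIV. cscale (A $ fst p $ snd p) (matrix_unit (fst p) (snd p))) $ a $ b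
        = (\<Sum>p\<in>UNIV. if p = (a, b) then A $ a $ b else 0)"
      unfolding sum_component
      by (rule sum.cong) (auto simp: cscale_def matrix_unit_def)
    then show ?thesis by simp
  qed
  then show ?thesis by (simp add: vec_eq_iff case_prod_unfold)
qed

interpretation cmat: finite_dimensional_vector_space
  "cscale :: complex \<Rightarrow> complex ^ 'n::finite ^ 'n \<Rightarrow> _" cmat_basis
proof -
  interpret vector_space "cscale :: complex \<Rightarrow> complex ^ 'n::finite ^ 'n \<Rightarrow> _"
    by (rule vector_space_cscale)
  show "finite_dimensional_vector_space (cscale :: complex \<Rightarrow> complex ^ 'n::finite ^ 'n \<Rightarrow> _) cmat_basis"
  proof
    show "finite (cmat_basis :: (complex ^ 'n ^ 'n) set)" by (simp add: cmat_basis_def)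
    have inj: "inj (\<lambda>(i, j). matrix_unit i j :: complex ^ 'n ^ 'n)"
      by (auto simp: inj_def matrix_unit_def vec_eq_iff)
    show "independent (cmat_basis :: (complex ^ 'n ^ 'n) set)"
    proof (rule independent_if_scalars_zero)
      show "finite (cmat_basis :: (complex ^ 'n ^ 'n) set)" by (simp add: cmat_basis_def)
      fix f :: "complex ^ 'n ^ 'n \<Rightarrow> complex" and x :: "complex ^ 'n ^ 'n"
      assume 0: "(\<Sum>x\<in>cmat_basis. cscale (f x) x) = 0" and x: "x \<in> cmat_basis"
      define A where "A = (\<chi> i j. f (matrix_unit i j))"
      have "(\<Sum>x\<in>cmat_basis. cscale (f x) x) = (\<Sum>(i, j)\<in>UNIV. cscale (A $ i $ j) (matrix_unit i j))"
        unfolding cmat_basis_def sum.reindex[OF inj]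
        by (rule sum.cong) (simp_all add: A_def case_prod_unfold)
      then have A0: "A = 0" unfolding 0 sum_cscale_matrix_unit by (rule sym)
      obtain i j where ij: "x = matrix_unit i j" using x by (auto simp: cmat_basis_def)
      have "A $ i $ j = 0" unfolding A0 by simp
      then show "f x = 0" by (simp add: A_def ij)
    qed
    have "A \<in> span cmat_basis" for A :: "complex ^ 'n ^ 'n"
    proof -
      have "(\<Sum>(i, j)\<in>UNIV. cscale (A $ i $ j) (matrix_unit i j)) \<in> span cmat_basis"
        by (intro span_sum) (auto simp: cmat_basis_def intro!: span_scale intro: span_base)
      then show ?thesis by (simp add: sum_cscale_matrix_unit)
    qed
    then show "span cmat_basis = (UNIV :: (complex ^ 'n ^ 'n) set)" by auto
  qed
qed

definition lie_bracket :: "complex ^ 'n::finite ^ 'n \<Rightarrow> complex ^ 'n ^ 'n \<Rightarrow> complex ^ 'n ^ 'n" where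
  "lie_bracket x y = x ** y - y ** x"

definition lie_subalgebra :: "(complex ^ 'n::finite ^ 'n) set \<Rightarrow> bool" where
  "lie_subalgebra \<ff> \<longleftrightarrow> cmat.subspace \<ff> \<and> (\<forall>x\<in>\<ff>. \<forall>y\<in>\<ff>. lie_bracket x y \<in> \<ff>)"

definition sl_algebra :: "(complex ^ 'n::finite ^ 'n) set" where
  "sl_algebra = {A. trace A = 0}"

definition cartan_subalgebra :: "(complex ^ 'n::finite ^ 'n) set" where
  "cartan_subalgebra = {A \<in> sl_algebra. \<forall>i j. i \<noteq> j \<longrightarrow> A $ i $ j = 0}"

text \<open>An element of the dual of a subspace \<open>\<ff>\<close> is represented by a function on all
  matrices of which only the values on \<open>\<ff>\<close> are used.\<close>

definition linear_functional_on ::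
    "(complex ^ 'n::finite ^ 'n) set \<Rightarrow> (complex ^ 'n ^ 'n \<Rightarrow> complex) \<Rightarrow> bool" where
  "linear_functional_on \<ff> F \<longleftrightarrow>
     (\<forall>x\<in>\<ff>. \<forall>y\<in>\<ff>. F (x + y) = F x + F y) \<and> (\<forall>c. \<forall>x\<in>\<ff>. F (cscale c x) = c * F x)"

definition frobenius_functional ::
    "(complex ^ 'n::finite ^ 'n) set \<Rightarrow> (complex ^ 'n ^ 'n \<Rightarrow> complex) \<Rightarrow> bool" where
  "frobenius_functional \<ff> F \<longleftrightarrow> linear_functional_on \<ff> F \<and>
     (\<forall>x\<in>\<ff>. (\<forall>y\<in>\<ff>. F (lie_bracket x y) = 0) \<longrightarrow> x = 0)"

definition principal_element ::
    "(complex ^ 'n::finite ^ 'n) set \<Rightarrow> (complex ^ 'n ^ 'n \<Rightarrow> complex) \<Rightarrow> complex ^ 'n ^ 'n" where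
  "principal_element \<ff> F = (THE D. D \<in> \<ff> \<and> (\<forall>x\<in>\<ff>. F x = F (lie_bracket D x)))"

definition F_functional :: "('n::finite \<times> 'n) set \<Rightarrow> complex ^ 'n ^ 'n \<Rightarrow> complex" where
  "F_functional S A = (\<Sum>(i, j)\<in>S. A $ i $ j)"

definition graph_of :: "('n::finite \<times> 'n) set \<Rightarrow> 'n pair_pre_digraph" where
  "graph_of S = \<lparr>pverts = UNIV, parcs = S\<rparr>"

text \<open>\<open>Digraph_Component.connected\<close> is weak connectivity, i.e. connectivity of the
  underlying undirected graph. The unqualified name denotes the topological notion.\<close>

definition small :: "('n::finite \<times> 'n) set \<Rightarrow> bool" where
  "small S \<longleftrightarrow> (\<forall>(i, j)\<in>S. i \<noteq> j) \<and> card S = CARD('n) - 1 \<and>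
     Digraph_Component.connected (with_proj (graph_of S))"

definition undirected_component :: "('n::finite \<times> 'n) set \<Rightarrow> 'n \<Rightarrow> 'n set" where
  "undirected_component S i = {k. i \<rightarrow>\<^sup>*\<^bsub>with_proj (mk_symmetric (with_proj (graph_of S)))\<^esub> k}"

definition eps :: "'n::finite \<Rightarrow> complex ^ 'n ^ 'n" where
  "eps k = matrix_unit k k - cscale (1 / of_nat CARD('n)) (mat 1)"

definition d_elem :: "('n::finite \<times> 'n) set \<Rightarrow> 'n \<times> 'n \<Rightarrow> complex ^ 'n ^ 'n" where
  "d_elem S s = (\<Sum>k\<in>undirected_component (S - {s}) (fst s). eps k)"

definition D_elem :: "('n::finite \<times> 'n) set \<Rightarrow> complex ^ 'n ^ 'n" where
  "D_elem S = (\<Sum>s\<in>S. d_elem S s)"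

lemma linear_functional_on_F_functional: "linear_functional_on \<ff> (F_functional S)"
  by (auto simp: linear_functional_on_def F_functional_def cscale_def case_prod_unfold
      sum.distrib sum_distrib_left)

lemma rtrancl_on_UNIV: "rtrancl_on UNIV r = r\<^sup>*"
  by (auto intro: rtrancl_consistent_rtrancl_on rtrancl_on_rtranclI)

lemma undirected_component_eq: "undirected_component S i = {k. (i, k) \<in> (S \<union> S\<inverse>)\<^sup>*}"
proof -
  have "(\<Union>e\<in>S. {(fst e, snd e), (snd e, fst e)}) = S \<union> S\<inverse>" by force
  then show ?thesis
    by (simp add: undirected_component_def reachable_def mk_symmetric_def graph_of_def rtrancl_on_UNIV)
qed

lemma small_iff:
  fixes S :: "('n::finite \<times> 'n) set"
  shows "small S \<longleftrightarrow> (\<forall>(i, j)\<in>S. i \<noteq> j) \<and> card S = CARD('n) - 1 \<and>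
    (\<forall>i j. (i, j) \<in> (S \<union> S\<inverse>)\<^sup>*)"
proof -
  have "(\<Union>e\<in>S. {(fst e, snd e), (snd e, fst e)}) = S \<union> S\<inverse>" by force
  then show ?thesis
    by (simp add: small_def Digraph_Component.connected_def strongly_connected_def
        reachable_def mk_symmetric_def graph_of_def rtrancl_on_UNIV)
qed

text \<open>The description in the definition of \<open>principal_element\<close> is proper.\<close>

lemma lie_bracket_add_left: "lie_bracket (x + y) z = lie_bracket x z + lie_bracket y z"
  by (simp add: lie_bracket_def vec_eq_iff matrix_matrix_mult_def
      algebra_simps sum.distrib)

lemma lie_bracket_add_right: "lie_bracket z (x + y) = lie_bracket z x + lie_bracket z y"
  by (simp add: lie_bracket_def vec_eq_iff matrix_matrix_mult_def
      algebra_simps sum.distrib)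

lemma lie_bracket_cscale_left: "lie_bracket (cscale c x) z = cscale c (lie_bracket x z)"
  by (simp add: lie_bracket_def cscale_def vec_eq_iff matrix_matrix_mult_def
      sum_distrib_left right_diff_distrib ac_simps)

lemma lie_bracket_cscale_right: "lie_bracket z (cscale c x) = cscale c (lie_bracket z x)"
  by (simp add: lie_bracket_def cscale_def vec_eq_iff matrix_matrix_mult_def
      sum_distrib_left right_diff_distrib ac_simps)

lemma principal_element_ex1:
  assumes f: "lie_subalgebra \<ff>" and F: "frobenius_functional \<ff> F"
  shows "\<exists>!D. D \<in> \<ff> \<and> (\<forall>x\<in>\<ff>. F x = F (lie_bracket D x))"
proof -
  have sub: "cmat.subspace \<ff>" and cl: "\<And>x y. x \<in> \<ff> \<Longrightarrow> y \<in> \<ff> \<Longrightarrow> lie_bracket x y \<in> \<ff>"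
    using f by (auto simp: lie_subalgebra_def)
  have Fadd: "\<And>x y. x \<in> \<ff> \<Longrightarrow> y \<in> \<ff> \<Longrightarrow> F (x + y) = F x + F y"
    and Fsc: "\<And>c x. x \<in> \<ff> \<Longrightarrow> F (cscale c x) = c * F x"
    and nd: "\<And>x. x \<in> \<ff> \<Longrightarrow> (\<And>y. y \<in> \<ff> \<Longrightarrow> F (lie_bracket x y) = 0) \<Longrightarrow> x = 0"
    using F unfolding frobenius_functional_def linear_functional_on_def by blast+
  obtain B where B0: "B \<subseteq> \<ff>" "cmat.independent B" "\<ff> \<subseteq> cmat.span B"
    by (rule cmat.basis_exists[of \<ff>])
  note B = B0(1,2) cmat.span_subspace[OF B0(1,3) sub]
  have finB: "finite B" using B(2) by (rule cmat.finiteI_independent)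
  \<comment> \<open>linear maps on \<open>\<ff>\<close> that agree on \<open>B\<close> agree\<close>
  have ext: "g x = h x" if "x \<in> \<ff>"
    and g: "\<And>x y. x \<in> \<ff> \<Longrightarrow> y \<in> \<ff> \<Longrightarrow> g (x + y) = g x + g y" "\<And>c x. x \<in> \<ff> \<Longrightarrow> g (cscale c x) = c * g x"
    and h: "\<And>x y. x \<in> \<ff> \<Longrightarrow> y \<in> \<ff> \<Longrightarrow> h (x + y) = h x + h y" "\<And>c x. x \<in> \<ff> \<Longrightarrow> h (cscale c x) = c * h x"
    and gh: "\<And>b. b \<in> B \<Longrightarrow> g b = h b" for g h :: "_ \<Rightarrow> complex" and x
  proof -
    have "x \<in> {x \<in> \<ff>. g x = h x}"
    proof (rule cmat.span_induct)
      show "x \<in> cmat.span B" using that(1) B(3) by simp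
      have z: "0 \<in> \<ff>" using sub by (rule cmat.subspace_0)
      then have "g 0 = h 0" using g(2)[OF z, of 0] h(2)[OF z, of 0] by simp
      then show "cmat.subspace {a. a \<in> {x \<in> \<ff>. g x = h x}}" using sub g h
        by (auto simp: cmat.subspace_def)
    qed (use B gh in auto)
    then show ?thesis by simp
  qed
  define \<phi> where "\<phi> x = (\<Sum>b\<in>B. cscale (F (lie_bracket x b)) b)" for x
  have phi_add: "\<phi> (x + y) = \<phi> x + \<phi> y" if "x \<in> \<ff>" "y \<in> \<ff>" for x y
    using that B(1) by (auto simp: \<phi>_def lie_bracket_add_left Fadd cl subset_iff
        cmat.scale_left_distrib simp flip: sum.distrib intro!: sum.cong)
  have phi_sc: "\<phi> (cscale c x) = cscale c (\<phi> x)" if "x \<in> \<ff>" for c x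
    using that B(1) by (auto simp: \<phi>_def lie_bracket_cscale_left Fsc cl subset_iff
        cmat.scale_sum_right intro!: sum.cong)
  have coeff: "u b = v b" if "(\<Sum>b\<in>B. cscale (u b) b) = (\<Sum>b\<in>B. cscale (v b) b)" "b \<in> B" for u v b
  proof -
    have "(\<Sum>b\<in>B. cscale (u b - v b) b) = 0"
      using that(1) by (simp add: cmat.scale_left_diff_distrib sum_subtractf)
    then have "u b - v b = 0"
      using cmat.independentD[where u = "\<lambda>b. u b - v b", OF B(2) finB order_refl] that(2) by simp
    then show ?thesis by simp
  qed
  have key: "\<forall>y\<in>\<ff>. F (lie_bracket x y) = G y"
    if x: "x \<in> \<ff>" and eq: "\<phi> x = (\<Sum>b\<in>B. cscale (G b) b)"
      and G: "\<And>x y. x \<in> \<ff> \<Longrightarrow> y \<in> \<ff> \<Longrightarrow> G (x + y) = G x + G y" "\<And>c x. x \<in> \<ff> \<Longrightarrow> G (cscale c x) = c * G x"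
    for x G
  proof
    fix y assume y: "y \<in> \<ff>"
    show "F (lie_bracket x y) = G y"
    proof (rule ext[OF y, of "\<lambda>y. F (lie_bracket x y)" G])
      show "F (lie_bracket x b) = G b" if "b \<in> B" for b
        using coeff[OF eq[unfolded \<phi>_def] that] .
    qed (simp_all add: lie_bracket_add_right lie_bracket_cscale_right Fadd Fsc cl x G)
  qed
  have phi0: "x = 0" if "x \<in> \<ff>" "\<phi> x = 0" for x
    using key[OF that(1), of "\<lambda>_. 0"] that(2) nd[OF that(1)] by simp
  have phi_in: "\<phi> x \<in> \<ff>" for x
    unfolding \<phi>_def using sub B(1) by (intro cmat.subspace_sum cmat.subspace_scale) auto
  have inj: "inj_on \<phi> \<ff>"
  proof (rule inj_onI)
    fix x y assume xy: "x \<in> \<ff>" "y \<in> \<ff>" "\<phi> x = \<phi> y"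
    have my: "cscale (-1) y \<in> \<ff>" by (rule cmat.subspace_scale[OF sub xy(2)])
    have m: "cscale (-1) z = - z" for z :: "complex ^ 'n ^ 'n"
      by (simp add: cscale_def vec_eq_iff)
    have "\<phi> (x + cscale (-1) y) = \<phi> x + cscale (-1) (\<phi> y)"
      by (simp only: phi_add[OF xy(1) my] phi_sc[OF xy(2)])
    also have "\<dots> = 0" unfolding m using xy(3) by simp
    finally have "x + cscale (-1) y = 0"
      by (rule phi0[OF cmat.subspace_add[OF sub xy(1) my]])
    then show "x = y" unfolding m by simp
  qed
  have subim: "cmat.subspace (\<phi> ` \<ff>)"
    unfolding cmat.subspace_def
  proof (intro conjI ballI allI)
    have z: "0 \<in> \<ff>" using sub by (rule cmat.subspace_0)
    have "\<phi> 0 = 0" using phi_sc[OF z, of 0] by simp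
    then show "0 \<in> \<phi> ` \<ff>" using z by (metis imageI)
    show "x + y \<in> \<phi> ` \<ff>" if xy: "x \<in> \<phi> ` \<ff>" "y \<in> \<phi> ` \<ff>" for x y
    proof -
      obtain a b where "a \<in> \<ff>" "b \<in> \<ff>" "x = \<phi> a" "y = \<phi> b" using xy by blast
      then show ?thesis using phi_add sub by (metis imageI cmat.subspace_add)
    qed
    show "cscale c x \<in> \<phi> ` \<ff>" if x: "x \<in> \<phi> ` \<ff>" for c x
    proof -
      obtain a where "a \<in> \<ff>" "x = \<phi> a" using x by blast
      then show ?thesis using phi_sc sub by (metis imageI cmat.subspace_scale)
    qed
  qed
  have indim: "cmat.independent (\<phi> ` B)"
  proof (rule cmat.independent_if_scalars_zero)
    show "finite (\<phi> ` B)" using finB by simp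
    fix u z assume s0: "(\<Sum>z\<in>\<phi> ` B. cscale (u z) z) = 0" and z: "z \<in> \<phi> ` B"
    have injB: "inj_on \<phi> B" using inj B(1) by (rule inj_on_subset)
    define w where "w = (\<Sum>b\<in>B. cscale (u (\<phi> b)) b)"
    have gen: "A \<subseteq> B \<Longrightarrow> \<phi> (\<Sum>b\<in>A. cscale (u (\<phi> b)) b) = (\<Sum>b\<in>A. cscale (u (\<phi> b)) (\<phi> b))" for A
    proof -
      assume A: "A \<subseteq> B"
      then have "finite A" using finB finite_subset by blast
      then show ?thesis using A
      proof (induction A rule: finite_induct)
        case empty
        show ?case using phi_sc[OF cmat.subspace_0[OF sub], of 0] by simp
      next
        case (insert a A)
        have a: "a \<in> \<ff>" and A: "(\<Sum>b\<in>A. cscale (u (\<phi> b)) b) \<in> \<ff>"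
          using insert.prems B(1) sub by (auto intro!: cmat.subspace_sum cmat.subspace_scale)
        then show ?case using insert sub
          by (simp add: phi_add phi_sc cmat.subspace_scale)
      qed
    qed
    have "\<phi> w = 0" using gen[of B] s0 injB by (simp add: w_def sum.reindex)
    moreover have "w \<in> \<ff>" unfolding w_def using sub B(1)
      by (intro cmat.subspace_sum cmat.subspace_scale) auto
    ultimately have "w = 0" by (rule phi0[rotated])
    obtain b where b: "b \<in> B" "z = \<phi> b" using z by blast
    have "(\<Sum>b\<in>B. cscale (u (\<phi> b)) b) = (\<Sum>b\<in>B. cscale ((\<lambda>_. 0) b) b)"
      using \<open>w = 0\<close> by (simp add: w_def)
    from coeff[OF this b(1)] show "u z = 0" using b(2) by simp
  qed
  have "\<phi> ` \<ff> = \<ff>"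
  proof (rule cmat.subspace_dim_equal[OF subim sub])
    show "\<phi> ` \<ff> \<subseteq> \<ff>" using phi_in by blast
    have "cmat.dim \<ff> = card B" 
      using cmat.dim_span_eq_card_independent[OF B(2)] unfolding B(3) .
    also have "\<dots> = card (\<phi> ` B)"
      using inj_on_subset[OF inj B(1)] by (simp add: card_image)
    also have "\<dots> \<le> cmat.dim (\<phi> ` \<ff>)"
      using indim B(1) by (intro cmat.independent_card_le_dim) auto
    finally show "cmat.dim \<ff> \<le> cmat.dim (\<phi> ` \<ff>)" .
  qed
  moreover have "(\<Sum>b\<in>B. cscale (F b) b) \<in> \<ff>"
    using sub B(1) by (intro cmat.subspace_sum cmat.subspace_scale) auto
  ultimately have "(\<Sum>b\<in>B. cscale (F b) b) \<in> \<phi> ` \<ff>" by (rule ssubst)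
  then obtain D where D: "D \<in> \<ff>" "\<phi> D = (\<Sum>b\<in>B. cscale (F b) b)"
    by (elim imageE) (rule that, assumption, rule sym)
  have DF: "\<forall>x\<in>\<ff>. F (lie_bracket D x) = F x" using key[OF D Fadd Fsc] .
  show ?thesis
  proof (rule ex1I[of _ D])
    show "D \<in> \<ff> \<and> (\<forall>x\<in>\<ff>. F x = F (lie_bracket D x))" using D(1) DF by simp
    fix E assume E: "E \<in> \<ff> \<and> (\<forall>x\<in>\<ff>. F x = F (lie_bracket E x))"
    have "\<phi> E = \<phi> D" unfolding \<phi>_def using E DF B(1) by (intro sum.cong) auto
    then show "E = D" using inj E D(1) by (auto dest: inj_onD)
  qed
qed

end

theory Submission
  imports Defs
begin

text \<open>For a diagonal matrix \<open>D\<close> with entries \<open>D\<^sub>i\<close>, the \<open>(i, j)\<close> entry of \<open>[D, x]\<close> is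
  \<open>(D\<^sub>i - D\<^sub>j) x\<^sub>i\<^sub>j\<close>, so it suffices that \<open>D\<^sub>i - D\<^sub>j = 1\<close> for every edge \<open>(i, j)\<close> of the tree.
  Among the summands \<open>d\<^sub>t\<close> of \<open>D\<close>, the one with \<open>t = (i, j)\<close> contributes \<open>1\<close> since \<open>t\<close> is a
  bridge, and each of the others contributes \<open>0\<close> since the edge \<open>(i, j)\<close> survives the removal
  of \<open>t\<close>.\<close>

text \<open>A vertex set grown from a single vertex, one vertex at a time, gains with each new
  vertex an edge joining it to the earlier ones. That edge was not inside the earlier set, so n
  vertices require at least n - 1 edges.\<close>

lemma card_UNIV_le_Suc_card_if_connected:
  fixes S :: "('n::finite \<times> 'n) set"
  assumes conn: "\<And>i j. (i, j) \<in> (S \<union> S\<inverse>)\<^sup>*"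
  shows "CARD('n) \<le> Suc (card S)"
proof -
  have grow: "\<exists>T. card T = Suc k \<and> k \<le> card (S \<inter> T \<times> T)" if "Suc k \<le> CARD('n)" for k
    using that
  proof (induction k)
    case 0
    show ?case by (rule exI[of _ "{undefined}"]) simp
  next
    case (Suc k)
    then obtain T where T: "card T = Suc k" "k \<le> card (S \<inter> T \<times> T)" by auto
    obtain r where r: "r \<in> T" using T(1) by fastforce
    obtain v where v: "v \<notin> T" using T(1) Suc.prems by (metis UNIV_eq_I Suc_n_not_le_n)
    \<comment> \<open>Some edge leaves \<open>T\<close>: otherwise \<open>T\<close> is closed under
      adjacency, so everything reachable from \<open>r\<close> lies in \<open>T\<close>, but
      \<open>v\<close> does not.\<close>
    have "\<exists>a b. a \<in> T \<and> b \<notin> T \<and> (a, b) \<in> S \<union> S\<inverse>"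
    proof (rule ccontr)
      assume "\<not> ?thesis"
      then have step: "b \<in> T" if "a \<in> T" "(a, b) \<in> S \<union> S\<inverse>" for a b
        using that by blast
      have "w \<in> T" if "(r, w) \<in> (S \<union> S\<inverse>)\<^sup>*" for w
        using that by (induction rule: rtrancl_induct) (use r step in blast)+
      with conn v show False by blast
    qed
    then obtain a b e where ab: "a \<in> T" "b \<notin> T" and e: "e \<in> S" "e = (a, b) \<or> e = (b, a)" by blast
    have "insert e (S \<inter> T \<times> T) \<subseteq> S \<inter> insert b T \<times> insert b T" using ab e by auto
    then have "card (insert e (S \<inter> T \<times> T)) \<le> card (S \<inter> insert b T \<times> insert b T)"
      by (intro card_mono) auto
    moreover have "e \<notin> S \<inter> T \<times> T" using ab e by auto
    ultimately have "Suc k \<le> card (S \<inter> insert b T \<times> insert b T)" using T by simp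
    moreover have "card (insert b T) = Suc (Suc k)" using ab T by simp
    ultimately show ?case by blast
  qed
  have "Suc (CARD('n) - 1) = CARD('n)" by simp
  with grow[of "CARD('n) - 1"] obtain T where "CARD('n) - 1 \<le> card (S \<inter> T \<times> T)" by auto
  also have "\<dots> \<le> card S" by (intro card_mono) auto
  finally show ?thesis by simp
qed

text \<open>If the ends stayed connected, the remaining n - 2 edges would still connect all n
  vertices, which is too few.\<close>

lemma small_edge_is_bridge:
  fixes S :: "('n::finite \<times> 'n) set"
  assumes S: "small S" and s: "(i, j) \<in> S"
  shows "j \<notin> undirected_component (S - {(i, j)}) i"
proof
  let ?T = "S - {(i, j)}"
  let ?R = "(?T \<union> ?T\<inverse>)\<^sup>*"
  assume "j \<in> undirected_component ?T i"
  then have ij: "(i, j) \<in> ?R" by (simp add: undirected_component_eq)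
  have "sym ?R" by (intro sym_rtrancl) (auto simp: sym_def)
  with ij have "(j, i) \<in> ?R" by (rule symD[rotated])
  \<comment> \<open>A path avoiding the deleted edge replaces it, in either direction.\<close>
  with ij have "S \<union> S\<inverse> \<subseteq> ?R" by (auto intro: r_into_rtrancl)
  then have "(S \<union> S\<inverse>)\<^sup>* \<subseteq> ?R" by (rule rtrancl_subset_rtrancl)
  then have "CARD('n) \<le> Suc (card ?T)"
    using S by (intro card_UNIV_le_Suc_card_if_connected) (auto simp: small_iff)
  moreover have "card ?T < card S" using s by (intro card_Diff1_less) auto
  ultimately show False using S by (simp add: small_iff)
qed

lemma eps_component:
  "eps k $ a $ b = (if a = b then of_bool (a = k) - 1 / of_nat CARD('n) else 0)"
  for k :: "'n::finite"
  by (simp add: eps_def matrix_unit_def cscale_def mat_def)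

text \<open>The shift by I/n makes the trace 1 - n/n = 0.\<close>

lemma eps_in_cartan: "eps k \<in> cartan_subalgebra" for k :: "'n::finite"
  by (simp add: cartan_subalgebra_def sl_algebra_def trace_def eps_component
      sum_subtractf)

lemma subspace_cartan_subalgebra:
  "cmat.subspace (cartan_subalgebra :: (complex ^ 'n::finite ^ 'n) set)"
  by (auto simp: cmat.subspace_def cartan_subalgebra_def sl_algebra_def trace_def cscale_def
      sum.distrib simp flip: sum_distrib_left)

text \<open>Serves twice: it shows that \<open>D_elem S\<close> is diagonal and, as
  \<open>\<ff>\<close> contains the Cartan subalgebra, that it lies in \<open>\<ff>\<close>.\<close>

lemma D_elem_in_cartan: "D_elem S \<in> cartan_subalgebra"
  unfolding D_elem_def d_elem_def
  by (intro cmat.subspace_sum subspace_cartan_subalgebra eps_in_cartan)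

text \<open>The shifts in the \<open>eps k\<close> add up to a multiple of the identity, which
  cancels in a difference of diagonal entries; only membership in the component remains.\<close>

lemma d_elem_diff:
  fixes S :: "('n::finite \<times> 'n) set"
  shows "d_elem S s $ i $ i - d_elem S s $ j $ j =
    of_bool (i \<in> undirected_component (S - {s}) (fst s)) -
    of_bool (j \<in> undirected_component (S - {s}) (fst s))"
  by (simp add: d_elem_def eps_component sum_subtractf of_bool_def)

lemma undirected_component_edge:
  assumes "(i, j) \<in> S"
  shows "i \<in> undirected_component S k \<longleftrightarrow> j \<in> undirected_component S k"
  using assms by (auto simp: undirected_component_eq intro: rtrancl_into_rtrancl)

lemma D_elem_diff:
  fixes S :: "('n::finite \<times> 'n) set"
  assumes S: "small S" and s: "(i, j) \<in> S"
  shows "D_elem S $ i $ i - D_elem S $ j $ j = 1"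
proof -
  have "d_elem S t $ i $ i - d_elem S t $ j $ j = of_bool (t = (i, j))" for t
  proof (cases "t = (i, j)")
    case True
    have "i \<in> undirected_component (S - {(i, j)}) i" by (simp add: undirected_component_eq)
    with True small_edge_is_bridge[OF S s] show ?thesis by (simp add: d_elem_diff)
  next
    case False
    with s undirected_component_edge[of i j "S - {t}"] show ?thesis by (simp add: d_elem_diff)
  qed
  then have "D_elem S $ i $ i - D_elem S $ j $ j = (\<Sum>t\<in>S. of_bool (t = (i, j)))"
    by (simp add: D_elem_def flip: sum_subtractf)
  also have "\<dots> = 1" using s by (simp add: of_bool_def)
  finally show ?thesis .
qed

lemma lie_bracket_diagonal_component:
  assumes "\<And>i j. i \<noteq> j \<Longrightarrow> D $ i $ j = 0"
  shows "lie_bracket D x $ i $ j = (D $ i $ i - D $ j $ j) * x $ i $ j"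
proof -
  have "(\<Sum>k\<in>UNIV. D $ i $ k * x $ k $ j) = (\<Sum>k\<in>UNIV. if k = i then D $ i $ i * x $ i $ j else 0)"
    using assms by (intro sum.cong) auto
  moreover have "(\<Sum>k\<in>UNIV. x $ i $ k * D $ k $ j) = (\<Sum>k\<in>UNIV. if k = j then x $ i $ j * D $ j $ j else 0)"
    using assms by (intro sum.cong) auto
  ultimately show ?thesis
    by (simp add: lie_bracket_def matrix_matrix_mult_def algebra_simps)
qed

lemma F_functional_lie_bracket_D_elem:
  assumes "small S"
  shows "F_functional S (lie_bracket (D_elem S) x) = F_functional S x"
proof -
  have "\<And>i j. i \<noteq> j \<Longrightarrow> D_elem S $ i $ j = 0"
    using D_elem_in_cartan[of S] by (simp add: cartan_subalgebra_def)
  then show ?thesis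
    unfolding F_functional_def
    by (intro sum.cong) (auto simp: lie_bracket_diagonal_component D_elem_diff[OF assms])
qed

theorem theorem5:
  fixes \<ff> :: "(complex ^ 'n::finite ^ 'n) set"
    and S :: "('n \<times> 'n) set"
  assumes "CARD('n) \<ge> 2"
    and "lie_subalgebra \<ff>"
    and "cartan_subalgebra \<subseteq> \<ff>"
    and "\<ff> \<subseteq> sl_algebra"
    and "small S"
    and "frobenius_functional \<ff> (F_functional S)"
  shows "D_elem S = principal_element \<ff> (F_functional S)"
proof -
  have "D_elem S \<in> \<ff> \<and> (\<forall>x\<in>\<ff>. F_functional S x = F_functional S (lie_bracket (D_elem S) x))"
    using assms(3,5) D_elem_in_cartan by (auto simp: F_functional_lie_bracket_D_elem)
  \<comment> \<open>Non-degeneracy makes the element with this property unique, so the description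
    denotes \<open>D_elem S\<close>.\<close>
  then show ?thesis
    unfolding principal_element_def
    by (rule the1_equality[OF principal_element_ex1[OF assms(2,6)], symmetric])
qed

end
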